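(* Let $d\geq 3$ be an integer, $\alpha\in\mathbb{R}$, $0<\epsilon<1$ and $C>0$. Then for every $N_0\in\mathbb{N}$ there exist a finite undirected simple graph $G$ with $|V(G)|\geq N_0$, a weight function $w:V(G)\rightarrow\mathbb{R}_{>0}$ and an independent set $A\subseteq V(G)$ such that: (i) every vertex of $G$ has degree at least $2$ and at most $d-1$ (in particular, $G$ is $d$-claw free); (ii) for every independent set $X\subseteq V(G)$ with $|X|\leq C\cdot\log(|V(G)|)$ we have $w^\alpha(X)\leq w^\alpha(N(X,A))$; (iii) every maximum weight independent set $A^*$ of $G$ satisfies $w(A^* )\geq\frac{d-1-\epsilon}{2}\cdot w(A)$.
   Context: A $d$-claw is a star with a center adjacent to $d$ pairwise non-adjacent talons; a graph is $d$-claw free if it has no induced $d$-claw. For $U,W\subseteq V(G)$, $N(U,W):=\{x\in W:\exists u\in U:\{u,x\}\in E(G)\text{ or }u=x\}$. For $U\subseteq V(G)$, $w(U):=\sum_{u\in U}w(u)$ and $w^\alpha(U):=\sum_{u\in U}w(u)^\alpha$. $\log$ denotes the binary logarithm. *)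

theory Defs
  imports Complex_Main
begin

text \<open>A graph is given by its vertex set \<open>V\<close> and its set \<open>E\<close> of edges, which are
  two-element subsets of \<open>V\<close>; hence there are no loops and no parallel edges.\<close>

definition fin_simple_graph :: "'a set \<Rightarrow> 'a set set \<Rightarrow> bool" where
  "fin_simple_graph V E \<longleftrightarrow> finite V \<and> (\<forall>e\<in>E. e \<subseteq> V \<and> card e = 2)"

definition vertex_degree :: "'a set \<Rightarrow> 'a set set \<Rightarrow> 'a \<Rightarrow> nat" where
  "vertex_degree V E v = card {u \<in> V. {v, u} \<in> E}"

definition independent_set :: "'a set \<Rightarrow> 'a set set \<Rightarrow> 'a set \<Rightarrow> bool" where
  "independent_set V E X \<longleftrightarrow> X \<subseteq> V \<and> (\<forall>u\<in>X. \<forall>v\<in>X. {u, v} \<notin> E)"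

definition induced_claw :: "'a set \<Rightarrow> 'a set set \<Rightarrow> nat \<Rightarrow> 'a \<Rightarrow> 'a set \<Rightarrow> bool" where
  "induced_claw V E d c T \<longleftrightarrow>
     c \<in> V \<and> finite T \<and> card T = d \<and> independent_set V E T \<and> c \<notin> T \<and> (\<forall>t\<in>T. {c, t} \<in> E)"

definition claw_free :: "'a set \<Rightarrow> 'a set set \<Rightarrow> nat \<Rightarrow> bool" where
  "claw_free V E d \<longleftrightarrow> \<not> (\<exists>c T. induced_claw V E d c T)"

definition nbhd :: "'a set set \<Rightarrow> 'a set \<Rightarrow> 'a set \<Rightarrow> 'a set" where
  "nbhd E U W = {x \<in> W. \<exists>u\<in>U. {u, x} \<in> E \<or> u = x}"

definition weight :: "('a \<Rightarrow> real) \<Rightarrow> 'a set \<Rightarrow> real" where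
  "weight w U = (\<Sum>u\<in>U. w u)"

definition weight_pow :: "('a \<Rightarrow> real) \<Rightarrow> real \<Rightarrow> 'a set \<Rightarrow> real" where
  "weight_pow w \<alpha> U = (\<Sum>u\<in>U. w u powr \<alpha>)"

definition max_weight_independent_set ::
    "'a set \<Rightarrow> 'a set set \<Rightarrow> ('a \<Rightarrow> real) \<Rightarrow> 'a set \<Rightarrow> bool" where
  "max_weight_independent_set V E w S \<longleftrightarrow>
     independent_set V E S \<and> (\<forall>X. independent_set V E X \<longrightarrow> weight w X \<le> weight w S)"

end

theory Submission
  imports Defs "HOL-Real_Asymp.Real_Asymp"
begin

text \<open>Let \<open>G\<close> be the vertex-edge incidence graph of a graph \<open>H\<close> with degrees between \<open>2\<close> and \<open>d - 1\<close>,
  let \<open>A\<close> be the vertices of \<open>H\<close> with weight \<open>1\<close> and \<open>B\<close> the edges of \<open>H\<close> with weight \<open>\<beta>\<close>.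
  An improving set is then a set of edges of \<open>H\<close> whose number exceeds \<open>\<beta>\<^sup>-\<^sup>\<alpha>\<close> times the number of
  vertices it covers.
  For \<open>\<alpha> \<le> 0\<close>, no such set exists if \<open>H\<close> is a cycle and \<open>\<beta> \<ge> 1\<close>, and \<open>\<beta>\<close> can be taken large.
  For \<open>\<alpha> > 0\<close>, let \<open>\<beta>\<close> be slightly less than \<open>1\<close>, so that \<open>q = \<beta>\<^sup>-\<^sup>\<alpha> > 1\<close>, and let \<open>H\<close> be almost
  \<open>(d - 1)\<close>-regular on \<open>N\<close> vertices with girth of order \<open>log N\<close>; then \<open>w(B)\<close> is about
  \<open>(d - 1)/2 * w(A)\<close>. In a subgraph with more than \<open>q\<close> times as many edges as vertices some ball grows
  like \<open>q\<^sup>r\<close> for \<open>r\<close> up to half the girth, so improving sets have size polynomial in \<open>N\<close>.\<close>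

subsection \<open>Parity of degrees and girth\<close>

definition inc_degree :: "'a set set \<Rightarrow> 'a \<Rightarrow> nat" where
  "inc_degree E v = card {e \<in> E. v \<in> e}"

definition odd_vertices :: "'a set set \<Rightarrow> 'a set" where
  "odd_vertices E = {v. odd (inc_degree E v)}"

text \<open>Cycles are replaced by nonempty edge sets without odd vertices: \<^const>\<open>odd_vertices\<close> is additive
  with respect to symmetric difference, so closing up two paths needs no choice of a branch point.\<close>

definition girth_ge :: "nat \<Rightarrow> 'a set set \<Rightarrow> bool" where
  "girth_ge g E \<longleftrightarrow> (\<forall>Y\<subseteq>E. finite Y \<and> Y \<noteq> {} \<and> odd_vertices Y = {} \<longrightarrow> g \<le> card Y)"

lemma girth_geD:
  "girth_ge g E \<Longrightarrow> Y \<subseteq> E \<Longrightarrow> finite Y \<Longrightarrow> Y \<noteq> {} \<Longrightarrow> odd_vertices Y = {} \<Longrightarrow> g \<le> card Y"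
  unfolding girth_ge_def by blast

lemma girth_ge_subset: "girth_ge g E \<Longrightarrow> E' \<subseteq> E \<Longrightarrow> girth_ge g E'"
  unfolding girth_ge_def by blast

lemma girth_ge_antimono: "girth_ge g E \<Longrightarrow> g' \<le> g \<Longrightarrow> girth_ge g' E"
  unfolding girth_ge_def by (meson le_trans)

lemma card_sym_diff:
  assumes "finite A" "finite B"
  shows "card (sym_diff A B) + 2 * card (A \<inter> B) = card A + card B"
proof -
  have "card (sym_diff A B) = card (A - B) + card (B - A)"
    using assms by (intro card_Un_disjoint) auto
  moreover have "card A = card (A - B) + card (A \<inter> B)"
    using assms(1) card_Int_Diff [of A B] by simp
  moreover have "card B = card (B - A) + card (A \<inter> B)"
    using assms(2) card_Int_Diff [of B A] by (simp add: Int_commute)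
  ultimately show ?thesis
    by simp
qed

lemma odd_vertices_sym_diff:
  assumes "finite A" "finite B"
  shows "odd_vertices (sym_diff A B) = sym_diff (odd_vertices A) (odd_vertices B)"
proof -
  have "odd (inc_degree (sym_diff A B) v) \<longleftrightarrow> odd (inc_degree A v) \<noteq> odd (inc_degree B v)" for v
  proof -
    have "{e \<in> sym_diff A B. v \<in> e} = sym_diff {e \<in> A. v \<in> e} {e \<in> B. v \<in> e}"
      by auto
    then have "inc_degree (sym_diff A B) v + 2 * card ({e \<in> A. v \<in> e} \<inter> {e \<in> B. v \<in> e})
        = inc_degree A v + inc_degree B v"
      unfolding inc_degree_def using assms card_sym_diff [of "{e \<in> A. v \<in> e}" "{e \<in> B. v \<in> e}"] by simp
    then show ?thesis
      by presburger
  qed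
  then show ?thesis
    by (auto simp: odd_vertices_def)
qed

lemma odd_vertices_empty: "odd_vertices {} = {}"
  by (simp add: odd_vertices_def inc_degree_def)

lemma odd_vertices_singleton: "odd_vertices {e} = e"
proof -
  have "{e' \<in> {e}. v \<in> e'} = (if v \<in> e then {e} else {})" for v
    by auto
  then show ?thesis
    by (simp add: odd_vertices_def inc_degree_def)
qed

lemma odd_vertices_remove:
  assumes "finite Y" "e \<in> Y"
  shows "odd_vertices (Y - {e}) = sym_diff (odd_vertices Y) e"
proof -
  have "Y - {e} = sym_diff Y {e}"
    using assms(2) by blast
  then show ?thesis
    using odd_vertices_sym_diff [of Y "{e}"] assms(1) by (simp add: odd_vertices_singleton)
qed

lemma inc_degree_mono: "finite E \<Longrightarrow> E' \<subseteq> E \<Longrightarrow> inc_degree E' v \<le> inc_degree E v"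
  unfolding inc_degree_def by (intro card_mono) auto

lemma inc_degree_insert_le: "inc_degree (insert e E) v \<le> inc_degree E v + (if v \<in> e then 1 else 0)"
proof -
  have "{e' \<in> insert e E. v \<in> e'} = (if v \<in> e then insert e {e' \<in> E. v \<in> e'} else {e' \<in> E. v \<in> e'})"
    by auto
  then show ?thesis
    by (simp add: inc_degree_def card_insert_le_m1)
qed

lemma fin_simple_graph_card_edge: "fin_simple_graph V E \<Longrightarrow> e \<in> E \<Longrightarrow> card e = 2"
  by (simp add: fin_simple_graph_def)

lemma fin_simple_graph_edge_nonempty: "fin_simple_graph V E \<Longrightarrow> e \<in> E \<Longrightarrow> e \<noteq> {}"
  using fin_simple_graph_card_edge by fastforce

lemma fin_simple_graph_edges_subset: "fin_simple_graph V E \<Longrightarrow> E \<subseteq> Pow V"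
  by (auto simp: fin_simple_graph_def)

lemma fin_simple_graph_finite_edges: "fin_simple_graph V E \<Longrightarrow> finite E"
  by (meson fin_simple_graph_def fin_simple_graph_edges_subset finite_Pow_iff finite_subset)

lemma fin_simple_graph_subset: "fin_simple_graph V E \<Longrightarrow> E' \<subseteq> E \<Longrightarrow> fin_simple_graph V E'"
  by (auto simp: fin_simple_graph_def)

lemma inc_degree_eq_0:
  assumes "fin_simple_graph V E" "v \<notin> V"
  shows "inc_degree E v = 0"
proof -
  have "{e \<in> E. v \<in> e} = {}"
    using fin_simple_graph_edges_subset [OF assms(1)] assms(2) by blast
  then show ?thesis
    by (simp only: inc_degree_def card.empty)
qed

lemma sum_inc_degree:
  assumes "fin_simple_graph V E"
  shows "(\<Sum>v\<in>V. inc_degree E v) = 2 * card E"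
  unfolding inc_degree_def
proof (rule sum_multicount)
  show "\<forall>e\<in>E. card {v \<in> V. v \<in> e} = 2"
  proof
    fix e assume "e \<in> E"
    then have "{v \<in> V. v \<in> e} = e" "card e = 2"
      using assms by (auto simp: fin_simple_graph_def)
    then show "card {v \<in> V. v \<in> e} = 2"
      by simp
  qed
qed (use assms fin_simple_graph_finite_edges in \<open>auto simp: fin_simple_graph_def\<close>)

subsection \<open>Balls\<close>

primrec graph_ball :: "'a set set \<Rightarrow> 'a \<Rightarrow> nat \<Rightarrow> 'a set" where
  "graph_ball E u 0 = {u}"
| "graph_ball E u (Suc n) = nbhd E (graph_ball E u n) UNIV"

lemma graph_ball_Suc_superset: "graph_ball E u n \<subseteq> graph_ball E u (Suc n)"
  by (auto simp: nbhd_def)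

lemma graph_ball_mono_radius: "m \<le> n \<Longrightarrow> graph_ball E u m \<subseteq> graph_ball E u n"
  using graph_ball_Suc_superset by (rule lift_Suc_mono_le)

lemma graph_ball_mono_edges: "E' \<subseteq> E \<Longrightarrow> graph_ball E' u n \<subseteq> graph_ball E u n"
  by (induction n) (auto simp: nbhd_def)

lemma center_in_graph_ball: "u \<in> graph_ball E u n"
  using graph_ball_mono_radius [of 0 n E u] by simp

lemma graph_ball_edge: "x \<in> graph_ball E u n \<Longrightarrow> {x, y} \<in> E \<Longrightarrow> y \<in> graph_ball E u (Suc n)"
  by (auto simp: nbhd_def)

lemma graph_ball_subset_vertices: "fin_simple_graph V E \<Longrightarrow> u \<in> V \<Longrightarrow> graph_ball E u n \<subseteq> V"
  by (induction n) (auto simp: nbhd_def fin_simple_graph_def)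

lemma finite_graph_ball: "fin_simple_graph V E \<Longrightarrow> u \<in> V \<Longrightarrow> finite (graph_ball E u n)"
  using graph_ball_subset_vertices finite_subset by (metis fin_simple_graph_def)

lemma edge_subset_graph_ball_Suc:
  assumes "e \<in> E" "card e = 2" "e \<inter> graph_ball E u n \<noteq> {}"
  shows "e \<subseteq> graph_ball E u (Suc n)"
proof
  fix y assume "y \<in> e"
  obtain x where x: "x \<in> e" "x \<in> graph_ball E u n"
    using assms(3) by blast
  with assms(2) \<open>y \<in> e\<close> have "y = x \<or> e = {x, y}"
    by (auto simp: card_2_iff)
  then show "y \<in> graph_ball E u (Suc n)"
    using x assms(1) graph_ball_edge graph_ball_Suc_superset by fast
qed

lemma card_neighbours_le: "finite E \<Longrightarrow> card {y. {x, y} \<in> E} \<le> inc_degree E x"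
  unfolding inc_degree_def
  by (rule card_inj_on_le [where f = "\<lambda>y. {x, y}"]) (auto simp: inj_on_def doubleton_eq_iff)

lemma card_graph_ball_le:
  assumes "fin_simple_graph V E" "u \<in> V" "\<And>v. inc_degree E v \<le> k"
  shows "card (graph_ball E u n) \<le> Suc k ^ n"
proof (induction n)
  case (Suc n)
  have degree: "card (insert x {y. {x, y} \<in> E}) \<le> Suc k" for x
    using card_insert_le_m1 [of "Suc k" "{y. {x, y} \<in> E}" x] assms(3) [of x]
      card_neighbours_le [OF fin_simple_graph_finite_edges [OF assms(1)], of x] by simp
  have "graph_ball E u (Suc n) = (\<Union>x\<in>graph_ball E u n. insert x {y. {x, y} \<in> E})"
    by (auto simp: nbhd_def)
  then have "card (graph_ball E u (Suc n)) \<le> (\<Sum>x\<in>graph_ball E u n. card (insert x {y. {x, y} \<in> E}))"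
    using card_UN_le [OF finite_graph_ball [OF assms(1,2)]] by (simp only:)
  also have "\<dots> \<le> (\<Sum>x\<in>graph_ball E u n. Suc k)"
    using degree by (rule sum_mono)
  also have "\<dots> = card (graph_ball E u n) * Suc k"
    by simp
  also have "\<dots> \<le> Suc k ^ n * Suc k"
    using Suc.IH by (rule mult_le_mono1)
  finally show ?case
    by (simp add: mult.commute)
qed simp

lemma ex_path_if_in_graph_ball:
  assumes "\<forall>e\<in>E. card e = 2"
  shows "v \<in> graph_ball E u n \<Longrightarrow>
    \<exists>P\<subseteq>E. finite P \<and> card P \<le> n \<and> odd_vertices P = sym_diff {u} {v}"
proof (induction n arbitrary: v)
  case 0
  then show ?case
    by (intro exI [of _ "{}"]) (auto simp: odd_vertices_empty)
next
  case (Suc n)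
  from Suc.prems consider (inside) "v \<in> graph_ball E u n"
    | (new) x where "x \<in> graph_ball E u n" "{x, v} \<in> E"
    by (auto simp: nbhd_def)
  then show ?case
  proof cases
    case inside
    then show ?thesis
      using Suc.IH le_SucI by meson
  next
    case new
    obtain P where P: "P \<subseteq> E" "finite P" "card P \<le> n" "odd_vertices P = sym_diff {u} {x}"
      using Suc.IH [OF new(1)] by auto
    let ?P = "sym_diff P {{x, v}}"
    have "x \<noteq> v"
      using assms new(2) by fastforce
    then have "odd_vertices ?P = sym_diff {u} {v}"
      using P by (subst odd_vertices_sym_diff) (auto simp: odd_vertices_singleton)
    moreover have "card ?P \<le> Suc n"
      using card_sym_diff [of P "{{x, v}}"] P by simp
    ultimately show ?thesis
      using P new by (intro exI [of _ ?P]) auto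
  qed
qed

lemma in_graph_ball_if_odd_vertices:
  assumes "finite Y" "\<forall>e\<in>Y. card e = 2" "odd_vertices Y = sym_diff {u} {v}"
  shows "v \<in> graph_ball Y u (card Y)"
  using assms
proof (induction Y arbitrary: v rule: finite_psubset_induct)
  case (psubset Y)
  show ?case
  proof (cases "v = u")
    case False
    then have "v \<in> odd_vertices Y"
      using psubset.prems(2) by simp
    then have "{e \<in> Y. v \<in> e} \<noteq> {}"
      unfolding odd_vertices_def inc_degree_def by fastforce
    then obtain e where e: "e \<in> Y" "v \<in> e"
      by blast
    moreover have "card e = 2"
      using psubset.prems(1) e(1) by blast
    ultimately obtain x where x: "e = {x, v}" "x \<noteq> v"
      by (auto simp: card_2_iff)
    have "odd_vertices (Y - {e}) = sym_diff {u} {x}"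
      using odd_vertices_remove [OF psubset.hyps(1) e(1)] psubset.prems(2) x by auto
    then have "x \<in> graph_ball (Y - {e}) u (card (Y - {e}))"
      using psubset.prems(1) e(1) by (intro psubset.IH) auto
    then have "v \<in> graph_ball Y u (Suc (card (Y - {e})))"
      using graph_ball_mono_edges [of "Y - {e}" Y] e(1) x by (blast intro: graph_ball_edge)
    then show ?thesis
      using card_Suc_Diff1 [OF psubset.hyps(1) e(1)] by simp
  qed (simp add: center_in_graph_ball)
qed

lemma ex_parent_edges:
  assumes "finite S" "\<forall>y\<in>S. \<exists>x\<in>R. {x, y} \<in> E"
  obtains P where "P \<subseteq> E" "card P \<le> card S" "\<forall>y\<in>S. \<exists>x\<in>R. {x, y} \<in> P"
proof -
  obtain parent where parent: "parent y \<in> R" "{parent y, y} \<in> E" if "y \<in> S" for y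
    using assms(2) by metis
  show thesis
    by (rule that [of "(\<lambda>y. {parent y, y}) ` S"]) (use parent assms(1) card_image_le in auto)
qed

lemma ex_spanning_subgraph_graph_ball:
  assumes "fin_simple_graph V E" "u \<in> V"
  shows "\<exists>T\<subseteq>E. card T \<le> card (graph_ball E u n) \<and> graph_ball E u n \<subseteq> graph_ball T u n"
proof (induction n)
  case 0
  then show ?case
    by (intro exI [of _ "{}"]) auto
next
  case (Suc n)
  define inner new where "inner = graph_ball E u n" and "new = graph_ball E u (Suc n) - inner"
  have fin: "finite inner" "finite new"
    using finite_graph_ball [OF assms] by (auto simp: inner_def new_def simp del: graph_ball.simps)
  obtain T where T: "T \<subseteq> E" "card T \<le> card inner" "inner \<subseteq> graph_ball T u n"
    using Suc.IH by (auto simp: inner_def)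
  have "\<forall>y\<in>new. \<exists>x\<in>inner. {x, y} \<in> E"
    by (auto simp: new_def inner_def nbhd_def)
  then obtain P where P: "P \<subseteq> E" "card P \<le> card new" "\<forall>y\<in>new. \<exists>x\<in>inner. {x, y} \<in> P"
    using ex_parent_edges [OF fin(2)] by blast
  have ball: "graph_ball E u (Suc n) = inner \<union> new"
    using graph_ball_Suc_superset [of E u n] by (auto simp: inner_def new_def simp del: graph_ball.simps)
  have inner: "inner \<subseteq> graph_ball (T \<union> P) u n"
    using T(3) graph_ball_mono_edges [of T "T \<union> P" u n] by auto
  have "card (T \<union> P) \<le> card inner + card new"
    using card_Un_le [of T P] T(2) P(2) by linarith
  also have "\<dots> = card (inner \<union> new)"
    using fin by (intro card_Un_disjoint [symmetric]) (auto simp: new_def)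
  finally have "card (T \<union> P) \<le> card (graph_ball E u (Suc n))"
    using ball by simp
  moreover have "new \<subseteq> graph_ball (T \<union> P) u (Suc n)"
    using P(3) inner graph_ball_edge [of _ "T \<union> P"] by blast
  moreover have "inner \<subseteq> graph_ball (T \<union> P) u (Suc n)"
    using inner graph_ball_Suc_superset by (rule order_trans)
  ultimately show ?case
    unfolding ball using T(1) P(1) by (intro exI [of _ "T \<union> P"]) blast
qed

subsection \<open>Growth of balls in dense graphs of large girth\<close>

definition induced_edges :: "'a set set \<Rightarrow> 'a set \<Rightarrow> 'a set set" where
  "induced_edges E S = {e \<in> E. e \<subseteq> S}"

lemma induced_edges_subset: "induced_edges E S \<subseteq> E"
  by (auto simp: induced_edges_def)

lemma fin_simple_graph_induced_edges:
  "fin_simple_graph V E \<Longrightarrow> S \<subseteq> V \<Longrightarrow> fin_simple_graph S (induced_edges E S)"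
  by (auto simp: fin_simple_graph_def induced_edges_def intro: finite_subset)

lemma edge_in_subgraph_if_girth_ge:
  assumes girth: "girth_ge g E" "2 * n + 1 < g"
    and T: "T \<subseteq> E" "\<forall>e\<in>T. card e = 2"
    and xy: "{x, y} \<in> E" "x \<noteq> y" "x \<in> graph_ball T u n" "y \<in> graph_ball T u n"
  shows "{x, y} \<in> T"
proof (rule ccontr)
  assume notin: "{x, y} \<notin> T"
  obtain P Q where P: "P \<subseteq> T" "finite P" "card P \<le> n" "odd_vertices P = sym_diff {u} {x}"
    and Q: "Q \<subseteq> T" "finite Q" "card Q \<le> n" "odd_vertices Q = sym_diff {u} {y}"
    using ex_path_if_in_graph_ball [OF T(2)] xy(3,4) by meson
  define D where "D = sym_diff P Q"
  have D: "finite D" "D \<subseteq> T" "odd_vertices D = {x, y}"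
    using P Q xy(2) odd_vertices_sym_diff [of P Q] by (auto simp: D_def)
  have "card D \<le> 2 * n"
    using card_sym_diff [OF P(2) Q(2)] P(3) Q(3) by (simp add: D_def)
  then have "card (insert {x, y} D) \<le> 2 * n + 1"
    using D(1) by (simp add: card_insert_if)
  moreover have "g \<le> card (insert {x, y} D)"
  proof (rule girth_geD [OF girth(1)])
    have "insert {x, y} D = sym_diff D {{x, y}}"
      using D(2) notin by auto
    then show "odd_vertices (insert {x, y} D) = {}"
      using odd_vertices_sym_diff [of D "{{x, y}}"] D by (simp add: odd_vertices_singleton)
  qed (use D T xy in auto)
  ultimately show False
    using girth(2) by simp
qed

lemma card_induced_edges_graph_ball_le:
  assumes "fin_simple_graph V E" "u \<in> V" "girth_ge g E" "2 * n + 1 < g"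
  shows "card (induced_edges E (graph_ball E u n)) \<le> card (graph_ball E u n)"
proof -
  obtain T where T: "T \<subseteq> E" "card T \<le> card (graph_ball E u n)" "graph_ball E u n \<subseteq> graph_ball T u n"
    using ex_spanning_subgraph_graph_ball [OF assms(1,2)] by blast
  have "induced_edges E (graph_ball E u n) \<subseteq> T"
  proof
    fix e assume e: "e \<in> induced_edges E (graph_ball E u n)"
    then obtain x y where xy: "e = {x, y}" "x \<noteq> y"
      using fin_simple_graph_card_edge [OF assms(1), of e] by (auto simp: induced_edges_def card_2_iff)
    then have "{x, y} \<in> E" "x \<in> graph_ball T u n" "y \<in> graph_ball T u n"
      using e T(3) by (auto simp: induced_edges_def)
    moreover have "\<forall>e\<in>T. card e = 2"
      using T(1) fin_simple_graph_card_edge [OF assms(1)] by blast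
    ultimately show "e \<in> T"
      using xy edge_in_subgraph_if_girth_ge [OF assms(3,4) T(1)] by simp
  qed
  moreover have "finite T"
    using T(1) fin_simple_graph_finite_edges [OF assms(1)] by (rule finite_subset)
  ultimately show ?thesis
    using T(2) card_mono le_trans by blast
qed

lemma card_induced_edges_le_add:
  assumes "finite E"
  shows "card (induced_edges E F)
    \<le> card {e \<in> induced_edges E F. e \<inter> S \<noteq> {}} + card (induced_edges E (F - S))"
proof -
  have "card (induced_edges E F)
      \<le> card ({e \<in> induced_edges E F. e \<inter> S \<noteq> {}} \<union> induced_edges E (F - S))"
    using assms by (intro card_mono) (auto simp: induced_edges_def)
  also have "\<dots> \<le> card {e \<in> induced_edges E F. e \<inter> S \<noteq> {}} + card (induced_edges E (F - S))"
    by (rule card_Un_le)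
  finally show ?thesis .
qed

definition incidence_expanding :: "real \<Rightarrow> 'a set \<Rightarrow> 'a set set \<Rightarrow> bool" where
  "incidence_expanding q V E \<longleftrightarrow>
    (\<forall>S\<subseteq>V. q * real (card S) \<le> real (card {e \<in> E. e \<inter> S \<noteq> {}}))"

text \<open>A minimal vertex set spanning at least \<open>q\<close> times as many edges as it has vertices works, since
  removing \<open>S\<close> from it must destroy at least \<open>q |S|\<close> edges.\<close>

lemma ex_incidence_expanding_induced:
  fixes q :: real
  assumes graph: "fin_simple_graph V E" and "V \<noteq> {}" "q * card V \<le> card E"
  obtains F where "F \<subseteq> V" "F \<noteq> {}" "incidence_expanding q F (induced_edges E F)"
proof -
  define dense where "dense F \<longleftrightarrow> F \<subseteq> V \<and> F \<noteq> {} \<and> q * card F \<le> card (induced_edges E F)" for F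
  have "induced_edges E V = E"
    using graph by (auto simp: fin_simple_graph_def induced_edges_def)
  then have "dense V"
    using assms by (simp add: dense_def)
  then obtain F where "dense F" and minimal: "\<And>S. dense S \<Longrightarrow> card F \<le> card S"
    using ex_has_least_nat [of dense V card] by blast
  then have F: "F \<subseteq> V" "F \<noteq> {}" "q * card F \<le> card (induced_edges E F)"
    by (auto simp: dense_def)
  have fin: "finite F" "finite E"
    using F(1) graph fin_simple_graph_finite_edges finite_subset by (auto simp: fin_simple_graph_def)
  have "q * card S \<le> card {e \<in> induced_edges E F. e \<inter> S \<noteq> {}}" if S: "S \<subseteq> F" for S
  proof (cases "S = {}")
    case False
    have "real (card (induced_edges E (F - S))) \<le> q * card (F - S)"
    proof (cases "F - S = {}")
      case True
      have "induced_edges E {} = {}"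
        using fin_simple_graph_edge_nonempty [OF graph] by (auto simp: induced_edges_def)
      then show ?thesis
        by (simp only: True) simp
    next
      case nonempty: False
      have "card (F - S) < card F"
        using S False fin(1) by (intro psubset_card_mono) auto
      then have "\<not> dense (F - S)"
        using minimal [of "F - S"] by linarith
      then show ?thesis
        using nonempty F(1) by (auto simp: dense_def)
    qed
    moreover have "q * card F = q * card S + q * card (F - S)"
      using S fin(1) card_Int_Diff [of F S] by (simp add: Int_absorb1 distrib_left)
    ultimately show ?thesis
      using F(3) card_induced_edges_le_add [OF fin(2), of F S] by linarith
  qed simp
  then show thesis
    using that F(1,2) by (simp add: incidence_expanding_def)
qed

text \<open>The edges meeting a ball lie in the ball whose radius is larger by one; this is a tree, so it
  has at least as many vertices as edges.\<close>

lemma power_le_card_graph_ball: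
  fixes q :: real
  assumes graph: "fin_simple_graph V E" "u \<in> V" and girth: "girth_ge g E"
    and expanding: "incidence_expanding q V E" and "0 \<le> q"
  shows "2 * n + 1 < g \<Longrightarrow> q ^ n \<le> card (graph_ball E u n)"
proof (induction n)
  case (Suc n)
  let ?ball = "graph_ball E u"
  have "q ^ Suc n \<le> q * card (?ball n)"
    using Suc \<open>0 \<le> q\<close> by (simp add: mult_left_mono)
  also have "\<dots> \<le> card {e \<in> E. e \<inter> ?ball n \<noteq> {}}"
    using expanding graph_ball_subset_vertices [OF graph] by (simp add: incidence_expanding_def)
  also have "\<dots> \<le> card (induced_edges E (?ball (Suc n)))"
  proof (intro of_nat_mono card_mono)
    have "e \<subseteq> ?ball (Suc n)" if "e \<in> E" "e \<inter> ?ball n \<noteq> {}" for e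
      using that fin_simple_graph_card_edge [OF graph(1)] by (intro edge_subset_graph_ball_Suc)
    then show "{e \<in> E. e \<inter> ?ball n \<noteq> {}} \<subseteq> induced_edges E (?ball (Suc n))"
      unfolding induced_edges_def by blast
    show "finite (induced_edges E (?ball (Suc n)))"
      using finite_subset [OF induced_edges_subset] fin_simple_graph_finite_edges [OF graph(1)] .
  qed
  also have "\<dots> \<le> card (?ball (Suc n))"
    using card_induced_edges_graph_ball_le [OF graph girth Suc.prems] by (rule of_nat_mono)
  finally show ?case .
qed simp

lemma power_le_card_if_dense:
  fixes q :: real
  assumes graph: "fin_simple_graph V E" and girth: "girth_ge g E" "2 * r + 1 < g"
    and dense: "V \<noteq> {}" "q * card V \<le> card E" and "0 \<le> q"
  shows "q ^ r \<le> card V"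
proof -
  obtain F where F: "F \<subseteq> V" "F \<noteq> {}" "incidence_expanding q F (induced_edges E F)"
    using ex_incidence_expanding_induced [OF graph dense] .
  then obtain u where u: "u \<in> F"
    by blast
  have graph_F: "fin_simple_graph F (induced_edges E F)"
    using graph F(1) by (rule fin_simple_graph_induced_edges)
  have "q ^ r \<le> card (graph_ball (induced_edges E F) u r)"
    using girth_ge_subset [OF girth(1) induced_edges_subset] F(3) \<open>0 \<le> q\<close> girth(2)
    by (rule power_le_card_graph_ball [OF graph_F u])
  also have "graph_ball (induced_edges E F) u r \<subseteq> V"
    using graph_ball_subset_vertices [OF graph_F u] F(1) by blast
  then have "real (card (graph_ball (induced_edges E F) u r)) \<le> card V"
    using graph by (intro of_nat_mono card_mono) (simp_all add: fin_simple_graph_def)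
  finally show ?thesis .
qed

definition locally_sparse :: "real \<Rightarrow> real \<Rightarrow> 'a set set \<Rightarrow> bool" where
  "locally_sparse L q E \<longleftrightarrow>
    (\<forall>Y\<subseteq>E. real (card Y) \<le> L \<longrightarrow> real (card Y) \<le> q * real (card (\<Union>Y)))"

lemma locally_sparse_mono:
  "locally_sparse L q E \<Longrightarrow> q \<le> q' \<Longrightarrow> locally_sparse L q' E"
  unfolding locally_sparse_def by (meson mult_right_mono of_nat_0_le_iff order_trans)

lemma locally_sparse_if_girth_ge:
  fixes L q :: real
  assumes graph: "fin_simple_graph V E" and girth: "girth_ge g E" "2 * r + 1 < g"
    and "1 \<le> q" "L < q ^ r"
  shows "locally_sparse L q E"
  unfolding locally_sparse_def
proof (intro allI impI, rule ccontr)
  fix Y assume Y: "Y \<subseteq> E" "card Y \<le> L" "\<not> card Y \<le> q * card (\<Union>Y)"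
  have graph_Y: "fin_simple_graph V Y"
    using graph Y(1) by (rule fin_simple_graph_subset)
  have "\<Union>Y \<subseteq> V"
    using fin_simple_graph_edges_subset [OF graph_Y] by blast
  then have "fin_simple_graph (\<Union>Y) Y"
    using graph_Y by (auto simp: fin_simple_graph_def intro: finite_subset)
  moreover have "\<Union>Y \<noteq> {}"
    using Y(3) fin_simple_graph_edge_nonempty [OF graph_Y] by fastforce
  moreover have "q * card (\<Union>Y) \<le> card Y" "0 \<le> q"
    using Y(3) \<open>1 \<le> q\<close> by simp_all
  ultimately have "q ^ r \<le> card (\<Union>Y)"
    using girth_ge_subset [OF girth(1) Y(1)] girth(2) by (intro power_le_card_if_dense)
  also have "\<dots> \<le> q * card (\<Union>Y)"
    using \<open>1 \<le> q\<close> mult_right_mono [of 1 q] by simp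
  finally show False
    using Y(2,3) \<open>L < q ^ r\<close> by simp
qed

subsection \<open>Edge-maximal graphs of large girth\<close>

definition degree_girth_graph :: "'a set \<Rightarrow> nat \<Rightarrow> nat \<Rightarrow> 'a set set \<Rightarrow> bool" where
  "degree_girth_graph V k g E \<longleftrightarrow>
     fin_simple_graph V E \<and> (\<forall>v. inc_degree E v \<le> k) \<and> girth_ge g E"

lemma in_graph_ball_if_not_girth_ge_insert:
  assumes graph: "fin_simple_graph V E" and girth: "girth_ge g E"
    and "u \<noteq> v" "\<not> girth_ge g (insert {u, v} E)"
  shows "v \<in> graph_ball E u g"
proof -
  obtain Y where Y: "Y \<subseteq> insert {u, v} E" "finite Y" "Y \<noteq> {}" "odd_vertices Y = {}" "card Y < g"
    using assms(4) by (auto simp: girth_ge_def not_le)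
  have uv: "{u, v} \<in> Y"
  proof (rule ccontr)
    assume "{u, v} \<notin> Y"
    then have "Y \<subseteq> E"
      using Y(1) by blast
    then show False
      using girth_geD [OF girth _ Y(2-4)] Y(5) by simp
  qed
  let ?path = "Y - {{u, v}}"
  have path: "?path \<subseteq> E"
    using Y(1) by blast
  have "odd_vertices ?path = sym_diff {u} {v}"
    using odd_vertices_remove [OF Y(2) uv] Y(4) \<open>u \<noteq> v\<close> by auto
  moreover have "\<forall>e\<in>?path. card e = 2"
    using path fin_simple_graph_card_edge [OF graph] by blast
  ultimately have "v \<in> graph_ball ?path u (card ?path)"
    using Y(2) by (intro in_graph_ball_if_odd_vertices) auto
  moreover have "card ?path \<le> g"
    using card_Diff1_le [of Y "{u, v}"] Y(5) by linarith
  ultimately show ?thesis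
    by (meson graph_ball_mono_edges [OF path] graph_ball_mono_radius subsetD)
qed

text \<open>In an edge-maximal graph, joining two vertices of degree less than \<open>k\<close> would close a short
  cycle; hence these vertices all lie in one ball of radius \<open>g\<close>.\<close>

lemma low_degree_in_graph_ball_if_maximal:
  assumes E: "degree_girth_graph V k g E"
    and maximal: "\<And>F. degree_girth_graph V k g F \<Longrightarrow> E \<subseteq> F \<Longrightarrow> F = E" and "1 \<le> g"
    and u: "u \<in> V" "inc_degree E u < k" and v: "v \<in> V" "inc_degree E v < k"
  shows "v \<in> graph_ball E u g"
proof -
  consider (equal) "u = v" | (adjacent) "{u, v} \<in> E" | (apart) "u \<noteq> v" "{u, v} \<notin> E"
    by blast
  then show ?thesis
  proof cases
    case equal
    then show ?thesis
      by (simp add: center_in_graph_ball)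
  next
    case adjacent
    then have "v \<in> graph_ball E u 1"
      by (auto simp: nbhd_def)
    then show ?thesis
      using graph_ball_mono_radius [OF \<open>1 \<le> g\<close>, of E u] by blast
  next
    case apart
    let ?F = "insert {u, v} E"
    have graph: "fin_simple_graph V E" and degree: "inc_degree E x \<le> k" and girth: "girth_ge g E" for x
      using E by (auto simp: degree_girth_graph_def)
    have "inc_degree ?F x \<le> k" for x
      using inc_degree_insert_le [of "{u, v}" E x] degree [of x] u v by (auto split: if_splits)
    moreover have "fin_simple_graph V ?F"
      using graph u v apart(1) by (auto simp: fin_simple_graph_def)
    moreover have "\<not> degree_girth_graph V k g ?F"
      using maximal [of ?F] apart(2) by blast
    ultimately have "\<not> girth_ge g ?F"
      by (simp add: degree_girth_graph_def)
    then show ?thesis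
      using in_graph_ball_if_not_girth_ge_insert [OF graph girth apart(1)] by blast
  qed
qed

lemma card_low_degree_le_if_maximal:
  assumes E: "degree_girth_graph V k g E"
    and maximal: "\<And>F. degree_girth_graph V k g F \<Longrightarrow> E \<subseteq> F \<Longrightarrow> F = E" and "1 \<le> g"
  shows "card {v \<in> V. inc_degree E v < k} \<le> Suc k ^ g"
proof (cases "\<exists>u\<in>V. inc_degree E u < k")
  case True
  then obtain u where u: "u \<in> V" "inc_degree E u < k"
    by blast
  have graph: "fin_simple_graph V E" and degree: "\<And>v. inc_degree E v \<le> k"
    using E by (auto simp: degree_girth_graph_def)
  have "{v \<in> V. inc_degree E v < k} \<subseteq> graph_ball E u g"
    using low_degree_in_graph_ball_if_maximal [OF assms u] by blast
  then have "card {v \<in> V. inc_degree E v < k} \<le> card (graph_ball E u g)"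
    using finite_graph_ball [OF graph u(1)] by (intro card_mono)
  also have "\<dots> \<le> Suc k ^ g"
    using graph u(1) degree by (rule card_graph_ball_le)
  finally show ?thesis .
next
  case False
  then have "{v \<in> V. inc_degree E v < k} = {}"
    by blast
  then show ?thesis
    by (simp only: card.empty)
qed

lemma mult_card_vertices_le:
  assumes "fin_simple_graph V E"
  shows "k * card V \<le> 2 * card E + k * card {v \<in> V. inc_degree E v < k}"
proof -
  have "finite V"
    using assms by (simp add: fin_simple_graph_def)
  have "k * card V = (\<Sum>v\<in>V. k)"
    by simp
  also have "\<dots> \<le> (\<Sum>v\<in>V. inc_degree E v + (if inc_degree E v < k then k else 0))"
    by (intro sum_mono) auto
  also have "\<dots> = 2 * card E + k * card {v \<in> V. inc_degree E v < k}"
    using \<open>finite V\<close> sum_inc_degree [OF assms] by (simp add: sum.distrib sum.If_cases Int_def)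
  finally show ?thesis .
qed

lemma degree_girth_graph_extend:
  assumes "degree_girth_graph V k g E\<^sub>0" "1 \<le> g"
  obtains E where "degree_girth_graph V k g E" "E\<^sub>0 \<subseteq> E" "k * card V \<le> 2 * card E + k * Suc k ^ g"
proof -
  let ?graphs = "{E. degree_girth_graph V k g E}"
  have "finite V"
    using assms(1) by (simp add: degree_girth_graph_def fin_simple_graph_def)
  moreover have "?graphs \<subseteq> Pow (Pow V)"
    by (auto simp: degree_girth_graph_def dest: fin_simple_graph_edges_subset)
  ultimately have "finite ?graphs"
    by (meson finite_Pow_iff finite_subset)
  then obtain E where E: "degree_girth_graph V k g E" "E\<^sub>0 \<subseteq> E"
    and maximal: "\<And>F. degree_girth_graph V k g F \<Longrightarrow> E \<subseteq> F \<Longrightarrow> F = E"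
    using finite_has_maximal2 [of ?graphs E\<^sub>0] assms(1) by auto
  have "k * card V \<le> 2 * card E + k * card {v \<in> V. inc_degree E v < k}"
    using E(1) by (intro mult_card_vertices_le) (simp add: degree_girth_graph_def)
  also have "\<dots> \<le> 2 * card E + k * Suc k ^ g"
    using card_low_degree_le_if_maximal [OF E(1) maximal assms(2)] by simp
  finally show thesis
    using that E by blast
qed

subsection \<open>Cycles\<close>

definition cycle_edge :: "nat \<Rightarrow> nat \<Rightarrow> nat set" where
  "cycle_edge n i = {i, Suc i mod n}"

definition cycle_edges :: "nat \<Rightarrow> nat set set" where
  "cycle_edges n = cycle_edge n ` {..<n}"

lemma inj_on_cycle_edge: "3 \<le> n \<Longrightarrow> inj_on (cycle_edge n) {..<n}"
  by (auto simp: inj_on_def cycle_edge_def mod_Suc doubleton_eq_iff split: if_splits)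

lemma card_cycle_edges: "3 \<le> n \<Longrightarrow> card (cycle_edges n) = n"
  by (simp add: cycle_edges_def card_image inj_on_cycle_edge)

lemma fin_simple_graph_cycle_edges: "2 \<le> n \<Longrightarrow> fin_simple_graph {..<n} (cycle_edges n)"
  by (auto simp: fin_simple_graph_def cycle_edges_def cycle_edge_def mod_Suc)

lemma cycle_edges_incident:
  assumes "3 \<le> n" "i < n"
  shows "{e \<in> cycle_edges n. Suc i mod n \<in> e} = {cycle_edge n i, cycle_edge n (Suc i mod n)}"
  using assms by (auto simp: cycle_edges_def cycle_edge_def mod_Suc split: if_splits)

lemma inc_degree_cycle_edges:
  assumes "3 \<le> n" "v < n"
  shows "inc_degree (cycle_edges n) v = 2"
proof -
  obtain i where i: "i < n" "v = Suc i mod n"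
  proof (cases v)
    case 0
    then show thesis
      using that [of "n - 1"] assms by simp
  next
    case (Suc i)
    then show thesis
      using that [of i] assms(2) by simp
  qed
  moreover have "i \<noteq> Suc i mod n" "Suc i mod n < n"
    using assms i(1) by (auto simp: mod_Suc)
  ultimately have "cycle_edge n i \<noteq> cycle_edge n (Suc i mod n)"
    using inj_on_cycle_edge [OF assms(1)] by (meson inj_onD lessThan_iff)
  then show ?thesis
    using cycle_edges_incident [OF assms(1) i(1)] i(2) by (simp add: inc_degree_def)
qed

lemma cycle_edge_Suc_mem_if_odd_vertices_empty:
  assumes Y: "Y \<subseteq> cycle_edges n" "odd_vertices Y = {}"
    and i: "3 \<le> n" "i < n" "cycle_edge n i \<in> Y"
  shows "cycle_edge n (Suc i mod n) \<in> Y"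
proof (rule ccontr)
  let ?v = "Suc i mod n"
  assume "cycle_edge n ?v \<notin> Y"
  moreover have "{e \<in> Y. ?v \<in> e} \<subseteq> {cycle_edge n i, cycle_edge n ?v}"
    using Y(1) cycle_edges_incident [OF i(1,2)] by blast
  ultimately have "{e \<in> Y. ?v \<in> e} = {cycle_edge n i}"
    using i(3) by (auto simp: cycle_edge_def)
  then have "inc_degree Y ?v = 1"
    by (simp add: inc_degree_def)
  then have "?v \<in> odd_vertices Y"
    by (simp add: odd_vertices_def)
  then show False
    using Y(2) by simp
qed

lemma Suc_mod_induct:
  assumes "i < n" "P i" and closed: "\<And>j. j < n \<Longrightarrow> P j \<Longrightarrow> P (Suc j mod n)" and "j < n"
  shows "P j"
proof -
  have "P ((i + t) mod n)" for t
  proof (induction t)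
    case (Suc t)
    have "P (Suc ((i + t) mod n) mod n)"
      using closed Suc \<open>i < n\<close> by simp
    then show ?case
      by (simp add: mod_Suc_eq)
  qed (use assms(1,2) in simp)
  then have "P ((i + (n + j - i)) mod n)" .
  then show ?thesis
    using assms(1,4) by simp
qed

lemma girth_ge_cycle_edges:
  assumes "3 \<le> n"
  shows "girth_ge n (cycle_edges n)"
  unfolding girth_ge_def
proof (intro allI impI, elim conjE)
  fix Y assume Y: "Y \<subseteq> cycle_edges n" "finite Y" "Y \<noteq> {}" "odd_vertices Y = {}"
  then obtain i where "i < n" "cycle_edge n i \<in> Y"
    by (auto simp: cycle_edges_def)
  then have "cycle_edge n j \<in> Y" if "j < n" for j
    using cycle_edge_Suc_mem_if_odd_vertices_empty [OF Y(1,4) assms] that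
    by (rule Suc_mod_induct [where P = "\<lambda>j. cycle_edge n j \<in> Y"])
  then have "cycle_edges n \<subseteq> Y"
    by (auto simp: cycle_edges_def)
  then show "n \<le> card Y"
    using card_mono [OF Y(2)] card_cycle_edges [OF assms] by metis
qed

lemma locally_sparse_cycle_edges: "locally_sparse L 1 (cycle_edges n)"
  unfolding locally_sparse_def
proof (intro allI impI)
  fix Y assume Y: "Y \<subseteq> cycle_edges n"
  let ?starts = "{i \<in> {..<n}. cycle_edge n i \<in> Y}"
  have "Y \<subseteq> cycle_edge n ` ?starts"
    using Y by (auto simp: cycle_edges_def)
  then have "card Y \<le> card ?starts"
    by (rule surj_card_le [rotated]) simp
  also have "\<dots> \<le> card (\<Union>Y)"
  proof (rule card_mono)
    show "finite (\<Union>Y)"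
      by (rule finite_subset [of _ "{..n}"]) (use Y in \<open>auto simp: cycle_edges_def cycle_edge_def\<close>)
    show "?starts \<subseteq> \<Union>Y"
      by (auto simp: cycle_edge_def)
  qed
  finally show "real (card Y) \<le> 1 * real (card (\<Union>Y))"
    by simp
qed

subsection \<open>Almost regular locally sparse graphs\<close>

lemma ex_near_regular_girth:
  assumes "2 \<le> k" "1 \<le> g" "3 \<le> n" "g \<le> n"
  obtains E where "fin_simple_graph {..<n} E" "girth_ge g E" "\<And>v. v < n \<Longrightarrow> inc_degree E v \<in> {2..k}"
    "k * n \<le> 2 * card E + k * Suc k ^ g"
proof -
  have "inc_degree (cycle_edges n) v \<le> k" for v
    using assms(1,3) inc_degree_cycle_edges [of n v]
      inc_degree_eq_0 [OF fin_simple_graph_cycle_edges, of n v] by (cases "v < n") auto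
  moreover have "girth_ge g (cycle_edges n)"
    using girth_ge_antimono [OF girth_ge_cycle_edges] assms(3,4) .
  ultimately have "degree_girth_graph {..<n} k g (cycle_edges n)"
    using assms(3) fin_simple_graph_cycle_edges by (simp add: degree_girth_graph_def)
  then obtain E where E: "degree_girth_graph {..<n} k g E" "cycle_edges n \<subseteq> E"
    "k * card {..<n} \<le> 2 * card E + k * Suc k ^ g"
    using degree_girth_graph_extend assms(2) by blast
  then have graph: "fin_simple_graph {..<n} E"
    by (simp add: degree_girth_graph_def)
  have "2 \<le> inc_degree E v" if "v < n" for v
    using inc_degree_mono [OF fin_simple_graph_finite_edges [OF graph] E(2), of v]
      inc_degree_cycle_edges [OF assms(3) that] by simp
  then show thesis
    using that graph E by (simp add: degree_girth_graph_def)
qed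

lemma ex_power_gt_linear:
  fixes q a b :: real
  assumes "1 < q"
  obtains r where "n \<le> r" "a * real r + b < q ^ r"
proof -
  have "eventually (\<lambda>r::nat. a * real r + b < q ^ r) sequentially"
    using assms by real_asymp
  then have "eventually (\<lambda>r. n \<le> r \<and> a * real r + b < q ^ r) sequentially"
    using eventually_ge_at_top [of n] by eventually_elim simp
  then show thesis
    using that eventually_happens [of _ sequentially] by auto
qed

lemma log_card_vertices_edges_le:
  assumes graph: "fin_simple_graph V E" "V \<noteq> {}" "\<And>v. v \<in> V \<Longrightarrow> inc_degree E v \<le> k"
    and card_V: "card V = M * Suc k ^ g"
  shows "log 2 (real (card V + card E)) \<le> log 2 M + real (g + 1) * log 2 (Suc k)"
proof -
  have "0 < card V"
    using graph(1,2) by (simp add: fin_simple_graph_def card_gt_0_iff)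
  then have "0 < M"
    using card_V by auto
  have "2 * card E \<le> k * card V"
    using sum_bounded_above [of V "inc_degree E" k] graph(3) sum_inc_degree [OF graph(1)]
    by (simp add: mult.commute)
  then have "card V + card E \<le> Suc k * card V"
    by simp
  also have "\<dots> = M * Suc k ^ (g + 1)"
    by (simp add: card_V algebra_simps)
  finally have "log 2 (real (card V + card E)) \<le> log 2 (real (M * Suc k ^ (g + 1)))"
    using \<open>0 < card V\<close> \<open>0 < M\<close>
    by (subst log_le_cancel_iff) (simp_all del: power_Suc of_nat_mult of_nat_add)
  also have "\<dots> = log 2 M + log 2 (real (Suc k) ^ (g + 1))"
    using \<open>0 < M\<close> by (simp only: of_nat_mult of_nat_power, subst log_mult_pos) simp_all
  also have "log 2 (real (Suc k) ^ (g + 1)) = real (g + 1) * log 2 (Suc k)"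
    by (intro log_nat_power) simp
  finally show ?thesis .
qed

lemma ex_near_regular_logarithmic_girth:
  fixes \<delta> :: real
  assumes k: "2 \<le> k" and "1 \<le> g" "3 \<le> M" "k \<le> \<delta> * M" and n: "n = M * Suc k ^ g"
  obtains E where "g \<le> n" "fin_simple_graph {..<n} E" "girth_ge g E"
    "\<And>v. v < n \<Longrightarrow> inc_degree E v \<in> {2..k}"
    "log 2 (real (n + card E)) \<le> log 2 M + real (g + 1) * log 2 (Suc k)" "(k - \<delta>) * n \<le> 2 * card E"
proof -
  have "g < Suc k ^ g"
    using less_exp [of g] power_mono [of 2 "Suc k" g] k by linarith
  moreover have "3 * Suc k ^ g \<le> n"
    unfolding n using \<open>3 \<le> M\<close> by (rule mult_le_mono1)
  ultimately have "3 \<le> n" "g \<le> n"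
    by auto
  then obtain E where graph: "fin_simple_graph {..<n} E" "girth_ge g E"
    and degree: "\<And>v. v < n \<Longrightarrow> inc_degree E v \<in> {2..k}"
    and edges: "k * n \<le> 2 * card E + k * Suc k ^ g"
    using ex_near_regular_girth [OF k \<open>1 \<le> g\<close>] by blast
  have "{..<n} \<noteq> {}" "card {..<n} = M * Suc k ^ g"
    using \<open>3 \<le> n\<close> by (auto simp: lessThan_empty_iff) (simp add: n)
  then have "log 2 (real (card {..<n} + card E)) \<le> log 2 M + real (g + 1) * log 2 (Suc k)"
    using degree by (intro log_card_vertices_edges_le [OF graph(1)]) auto
  moreover have "k * real (Suc k ^ g) \<le> \<delta> * n"
    using mult_right_mono [OF \<open>k \<le> \<delta> * M\<close>, of "real (Suc k ^ g)"] by (simp add: n mult.assoc)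
  then have "(k - \<delta>) * n \<le> 2 * card E"
    using of_nat_mono [OF edges, where 'a = real] by (simp add: algebra_simps)
  ultimately show thesis
    using that \<open>g \<le> n\<close> graph degree by simp
qed

lemma ex_near_regular_locally_sparse:
  fixes q \<delta> C :: real
  assumes "2 \<le> k" "1 < q" "0 < \<delta>" "0 < C"
  obtains n E where "n\<^sub>0 \<le> n" "fin_simple_graph {..<n} E" "\<And>v. v < n \<Longrightarrow> inc_degree E v \<in> {2..k}"
    "locally_sparse (C * log 2 (n + card E)) q E" "(k - \<delta>) * n \<le> 2 * card E"
proof -
  obtain M :: nat where M: "max 3 (k / \<delta>) \<le> M"
    using real_arch_simple by blast
  define a b where "a = 2 * log 2 (Suc k)" and "b = log 2 M + 3 * log 2 (Suc k)"
  obtain r where r: "n\<^sub>0 \<le> r" "C * a * r + C * b < q ^ r"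
    using ex_power_gt_linear [OF \<open>1 < q\<close>] .
  define g n where "g = 2 * r + 2" and "n = M * Suc k ^ g"
  have "1 \<le> g" "3 \<le> M" "k \<le> \<delta> * M"
    using M \<open>0 < \<delta>\<close> by (auto simp: g_def field_simps)
  then obtain E where "g \<le> n" and graph: "fin_simple_graph {..<n} E" "girth_ge g E"
    and degree: "\<And>v. v < n \<Longrightarrow> inc_degree E v \<in> {2..k}"
    and size: "log 2 (real (n + card E)) \<le> log 2 M + real (g + 1) * log 2 (Suc k)"
      "(k - \<delta>) * n \<le> 2 * card E"
    using ex_near_regular_logarithmic_girth [OF \<open>2 \<le> k\<close> _ _ _ n_def] by blast
  have "log 2 (n + card E) \<le> a * r + b"
    using size(1) by (simp add: a_def b_def g_def algebra_simps)
  then have "C * log 2 (n + card E) \<le> C * (a * r + b)"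
    using \<open>0 < C\<close> by (intro mult_left_mono) auto
  then have "C * log 2 (n + card E) < q ^ r"
    using r(2) by (simp add: algebra_simps)
  then have "locally_sparse (C * log 2 (n + card E)) q E"
    using \<open>1 < q\<close> by (intro locally_sparse_if_girth_ge [OF graph]) (auto simp: g_def)
  moreover have "n\<^sub>0 \<le> n"
    using r(1) \<open>g \<le> n\<close> by (simp add: g_def)
  ultimately show thesis
    using that graph(1) degree size(2) by blast
qed

lemma ex_edge_weight:
  fixes k \<epsilon> :: real
  assumes "1 \<le> k" "0 < \<epsilon>" "\<epsilon> < 1"
  obtains \<beta> where "0 < \<beta>" "\<beta> < 1" "k - \<epsilon> \<le> (k - \<epsilon> / 2) * \<beta>"
proof
  let ?\<beta> = "1 - \<epsilon> / (2 * k)"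
  show "0 < ?\<beta>" "?\<beta> < 1"
    using assms by (auto simp: field_simps)
  have "(k - \<epsilon> / 2) * ?\<beta> = k - \<epsilon> + \<epsilon>\<^sup>2 / (4 * k)"
    using assms(1) by (simp add: field_simps power2_eq_square)
  then show "k - \<epsilon> \<le> (k - \<epsilon> / 2) * ?\<beta>"
    using assms(1) by simp
qed

lemma ex_weighted_locally_sparse:
  fixes \<alpha> \<epsilon> C :: real
  assumes k: "2 \<le> k" and \<epsilon>: "0 < \<epsilon>" "\<epsilon> < 1" and "0 < C"
  obtains n E and \<beta> :: real where "n\<^sub>0 \<le> n" "fin_simple_graph {..<n} E"
    "\<And>v. v < n \<Longrightarrow> inc_degree E v \<in> {2..k}"
    "0 < \<beta>" "locally_sparse (C * log 2 (n + card E)) (\<beta> powr - \<alpha>) E"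
    "(k - \<epsilon>) / 2 * n \<le> \<beta> * card E"
proof (cases "\<alpha> \<le> 0")
  case True
  define n where "n = max n\<^sub>0 3"
  have n: "n\<^sub>0 \<le> n" "3 \<le> n"
    by (simp_all add: n_def)
  have "1 \<le> real k powr - \<alpha>"
    using k True by (intro ge_one_powr_ge_zero) auto
  then have "locally_sparse (C * log 2 (n + card (cycle_edges n))) (k powr - \<alpha>) (cycle_edges n)"
    by (rule locally_sparse_mono [OF locally_sparse_cycle_edges])
  moreover have "inc_degree (cycle_edges n) v \<in> {2..k}" if "v < n" for v
    using inc_degree_cycle_edges [OF n(2) that] k by simp
  moreover have "(k - \<epsilon>) / 2 * n \<le> real k * real (card (cycle_edges n))"
    unfolding card_cycle_edges [OF n(2)] using \<epsilon>(1) by (intro mult_right_mono) auto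
  ultimately show thesis
    using that [of n "cycle_edges n" k] n k fin_simple_graph_cycle_edges by simp
next
  case False
  obtain \<beta> where \<beta>: "0 < \<beta>" "\<beta> < 1" "k - \<epsilon> \<le> (k - \<epsilon> / 2) * \<beta>"
    using ex_edge_weight [of k \<epsilon>] k \<epsilon> by auto
  then have "1 < \<beta> powr - \<alpha>"
    using False powr_less_mono2_neg [of "- \<alpha>" \<beta> 1] by simp
  then obtain n E where graph: "n\<^sub>0 \<le> n" "fin_simple_graph {..<n} E"
      "\<And>v. v < n \<Longrightarrow> inc_degree E v \<in> {2..k}" "locally_sparse (C * log 2 (n + card E)) (\<beta> powr - \<alpha>) E"
    and edges: "(k - \<epsilon> / 2) * n \<le> 2 * card E"
    using ex_near_regular_locally_sparse [OF k, of "\<beta> powr - \<alpha>" "\<epsilon> / 2" C] \<epsilon>(1) \<open>0 < C\<close> by auto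
  have "(k - \<epsilon>) * n \<le> (k - \<epsilon> / 2) * \<beta> * n"
    using \<beta>(3) by (intro mult_right_mono) auto
  also have "\<dots> \<le> 2 * (\<beta> * card E)"
    using mult_left_mono [OF edges, of \<beta>] \<beta>(1) by (simp add: mult_ac)
  finally have "(k - \<epsilon>) / 2 * n \<le> \<beta> * card E"
    by simp
  then show thesis
    using that graph \<beta>(1) by blast
qed

subsection \<open>Claws and local optima\<close>

lemma claw_free_if_vertex_degree_less:
  assumes "finite V" "\<And>v. v \<in> V \<Longrightarrow> vertex_degree V E v < d"
  shows "claw_free V E d"
  unfolding claw_free_def
proof (intro notI, elim exE)
  fix c T assume claw: "induced_claw V E d c T"
  then have "T \<subseteq> {u \<in> V. {c, u} \<in> E}"
    by (auto simp: induced_claw_def independent_set_def)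
  then have "card T \<le> vertex_degree V E c"
    unfolding vertex_degree_def using assms(1) by (intro card_mono) auto
  then show False
    using claw assms(2) [of c] by (simp add: induced_claw_def)
qed

text \<open>\<open>X \<inter> A\<close> and the neighbours of \<open>X - A\<close> in \<open>A\<close> are disjoint since \<open>X\<close> is independent.\<close>

lemma weight_pow_le_nbhd_if_diff:
  assumes "independent_set V E X" "finite X" "finite A"
    and diff: "weight_pow w \<alpha> (X - A) \<le> weight_pow w \<alpha> (nbhd E (X - A) A)"
  shows "weight_pow w \<alpha> X \<le> weight_pow w \<alpha> (nbhd E X A)"
proof -
  have fin: "finite (nbhd E Y A)" for Y
    using \<open>finite A\<close> by (simp add: nbhd_def)
  have "weight_pow w \<alpha> X = weight_pow w \<alpha> (X \<inter> A) + weight_pow w \<alpha> (X - A)"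
    unfolding weight_pow_def using \<open>finite X\<close> by (rule sum.Int_Diff)
  also have "\<dots> \<le> weight_pow w \<alpha> (X \<inter> A) + weight_pow w \<alpha> (nbhd E (X - A) A)"
    using diff by simp
  also have "\<dots> = weight_pow w \<alpha> (X \<inter> A \<union> nbhd E (X - A) A)"
    unfolding weight_pow_def using assms(1,2) fin
    by (intro sum.union_disjoint [symmetric]) (auto simp: nbhd_def independent_set_def)
  also have "\<dots> \<le> weight_pow w \<alpha> (nbhd E X A)"
    unfolding weight_pow_def using fin by (intro sum_mono2) (auto simp: nbhd_def)
  finally show ?thesis .
qed

subsection \<open>Incidence graphs\<close>

text \<open>The block \<open>e\<close> is represented by the vertex \<open>f e\<close>, so that the incidence graph of a set system
  over \<^typ>\<open>'a\<close> is again a graph over \<^typ>\<open>'a\<close>.\<close>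

locale incidence_graph =
  fixes V :: "'a set" and H :: "'a set set" and f :: "'a set \<Rightarrow> 'a"
  assumes finite_points: "finite V"
    and blocks_subset: "H \<subseteq> Pow V"
    and inj_on_blocks: "inj_on f H"
    and disjoint: "f ` H \<inter> V = {}"
begin

definition vertices :: "'a set" where
  "vertices = V \<union> f ` H"

definition edges :: "'a set set" where
  "edges = {{v, f e} | v e. e \<in> H \<and> v \<in> e}"

definition block_weight :: "real \<Rightarrow> 'a \<Rightarrow> real" where
  "block_weight \<beta> v = (if v \<in> V then 1 else \<beta>)"

lemma finite_blocks: "finite H"
  using blocks_subset finite_points by (meson finite_Pow_iff finite_subset)

lemma finite_vertices: "finite vertices"
  using finite_points finite_blocks by (simp add: vertices_def)

lemma card_vertices: "card vertices = card V + card H"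
  unfolding vertices_def using finite_points finite_blocks disjoint
  by (subst card_Un_disjoint) (auto simp: card_image inj_on_blocks)

lemma block_vertex_notin: "e \<in> H \<Longrightarrow> f e \<notin> V"
  using disjoint by blast

lemma point_in_block: "e \<in> H \<Longrightarrow> v \<in> e \<Longrightarrow> v \<in> V"
  using blocks_subset by blast

lemma point_edge_iff: "v \<in> V \<Longrightarrow> {v, u} \<in> edges \<longleftrightarrow> (\<exists>e\<in>H. v \<in> e \<and> u = f e)"
  using block_vertex_notin by (fastforce simp: edges_def doubleton_eq_iff)

lemma block_edge_iff: "e \<in> H \<Longrightarrow> {f e, u} \<in> edges \<longleftrightarrow> u \<in> e"
  using block_vertex_notin point_in_block inj_on_blocks
  by (fastforce simp: edges_def doubleton_eq_iff dest: inj_onD)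

lemma fin_simple_graph_vertices_edges: "fin_simple_graph vertices edges"
  unfolding fin_simple_graph_def
proof (intro conjI ballI)
  fix x assume "x \<in> edges"
  then obtain v e where "x = {v, f e}" "e \<in> H" "v \<in> V"
    using point_in_block by (auto simp: edges_def)
  moreover from this have "v \<noteq> f e"
    using block_vertex_notin by blast
  ultimately show "x \<subseteq> vertices" "card x = 2"
    by (auto simp: vertices_def)
qed (rule finite_vertices)

lemma independent_set_points: "independent_set vertices edges V"
  using block_vertex_notin by (auto simp: independent_set_def vertices_def point_edge_iff)

lemma independent_set_blocks: "independent_set vertices edges (f ` H)"
  using block_vertex_notin point_in_block
  by (auto simp: independent_set_def vertices_def block_edge_iff)

lemma vertex_degree_point:
  assumes "v \<in> V"
  shows "vertex_degree vertices edges v = inc_degree H v"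
proof -
  have "{u \<in> vertices. {v, u} \<in> edges} = f ` {e \<in> H. v \<in> e}"
    using assms by (auto simp: vertices_def point_edge_iff)
  moreover have "inj_on f {e \<in> H. v \<in> e}"
    using inj_on_blocks by (rule inj_on_subset) auto
  ultimately show ?thesis
    by (simp add: vertex_degree_def inc_degree_def card_image)
qed

lemma vertex_degree_block:
  assumes "e \<in> H"
  shows "vertex_degree vertices edges (f e) = card e"
proof -
  have "{u \<in> vertices. {f e, u} \<in> edges} = e"
    using assms point_in_block by (auto simp: vertices_def block_edge_iff)
  then show ?thesis
    by (simp add: vertex_degree_def)
qed

lemma vertex_degree_mem:
  assumes "\<And>v. v \<in> V \<Longrightarrow> inc_degree H v \<in> D" "\<And>e. e \<in> H \<Longrightarrow> card e \<in> D" "v \<in> vertices"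
  shows "vertex_degree vertices edges v \<in> D"
proof (cases "v \<in> V")
  case True
  then show ?thesis
    using assms(1) by (simp add: vertex_degree_point)
next
  case False
  with assms(3) obtain e where "e \<in> H" "v = f e"
    by (auto simp: vertices_def)
  then show ?thesis
    using assms(2) by (simp add: vertex_degree_block)
qed

lemma nbhd_blocks: "Y \<subseteq> H \<Longrightarrow> nbhd edges (f ` Y) V = \<Union>Y"
  using block_edge_iff block_vertex_notin point_in_block by (fastforce simp: nbhd_def)

lemma weight_pow_points: "X \<subseteq> V \<Longrightarrow> weight_pow (block_weight \<beta>) \<alpha> X = card X"
  by (auto simp: weight_pow_def block_weight_def subset_eq)

lemma weight_pow_blocks:
  assumes "Y \<subseteq> H"
  shows "weight_pow (block_weight \<beta>) \<alpha> (f ` Y) = card Y * \<beta> powr \<alpha>"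
proof -
  have "inj_on f Y"
    using inj_on_blocks assms by (rule inj_on_subset)
  then show ?thesis
    using assms block_vertex_notin by (auto simp: weight_pow_def block_weight_def sum.reindex subset_eq)
qed

lemma weight_points: "weight (block_weight \<beta>) V = card V"
  by (simp add: weight_def block_weight_def)

lemma weight_blocks: "weight (block_weight \<beta>) (f ` H) = \<beta> * card H"
  using block_vertex_notin by (simp add: weight_def block_weight_def sum.reindex inj_on_blocks)

lemma weight_pow_le_nbhd_if_locally_sparse:
  fixes L \<beta> \<alpha> :: real
  assumes sparse: "locally_sparse L (\<beta> powr - \<alpha>) H" and "0 < \<beta>"
    and X: "independent_set vertices edges X" "card X \<le> L"
  shows "weight_pow (block_weight \<beta>) \<alpha> X \<le> weight_pow (block_weight \<beta>) \<alpha> (nbhd edges X V)"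
proof -
  have "X \<subseteq> vertices"
    using X(1) by (simp add: independent_set_def)
  then have "finite X"
    using finite_vertices by (rule finite_subset)
  have "X - V \<subseteq> f ` H"
    using \<open>X \<subseteq> vertices\<close> by (auto simp: vertices_def)
  then obtain Y where Y: "Y \<subseteq> H" "X - V = f ` Y"
    by (meson subset_imageE)
  have "card Y = card (X - V)"
    using Y inj_on_subset [OF inj_on_blocks] by (simp add: card_image)
  also have "\<dots> \<le> card X"
    using \<open>finite X\<close> by (intro card_mono) auto
  finally have "real (card Y) \<le> \<beta> powr - \<alpha> * card (\<Union>Y)"
    using sparse Y(1) X(2) by (simp add: locally_sparse_def)
  then have "card Y * \<beta> powr \<alpha> \<le> card (\<Union>Y)"
    using \<open>0 < \<beta>\<close> by (simp add: powr_minus field_simps)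
  moreover have "\<Union>Y \<subseteq> V"
    using Y(1) blocks_subset by blast
  ultimately have "weight_pow (block_weight \<beta>) \<alpha> (X - V)
      \<le> weight_pow (block_weight \<beta>) \<alpha> (nbhd edges (X - V) V)"
    using Y by (simp add: weight_pow_blocks weight_pow_points nbhd_blocks)
  with X(1) \<open>finite X\<close> finite_points show ?thesis
    by (rule weight_pow_le_nbhd_if_diff)
qed

lemma weight_blocks_le_max_weight:
  "max_weight_independent_set vertices edges (block_weight \<beta>) S \<Longrightarrow>
    \<beta> * card H \<le> weight (block_weight \<beta>) S"
  using independent_set_blocks by (auto simp: max_weight_independent_set_def simp flip: weight_blocks)

end

lemma ex_incidence_graph:
  fixes V :: "'a set"
  assumes "infinite (UNIV :: 'a set)" "finite V" "H \<subseteq> Pow V"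
  obtains f where "incidence_graph V H f"
proof -
  have "finite H"
    using assms(2,3) by (meson finite_Pow_iff finite_subset)
  obtain W where W: "finite W" "card W = card H" "W \<subseteq> - V"
    using infinite_arbitrarily_large [of "- V" "card H"] assms(1,2)
    by (metis Compl_eq_Diff_UNIV finite_Diff2)
  then obtain f where "bij_betw f H W"
    using finite_same_card_bij [OF \<open>finite H\<close>] by metis
  then have "incidence_graph V H f"
    using assms W(3) by unfold_locales (auto simp: bij_betw_def)
  then show thesis
    using that by blast
qed

theorem theorem42:
  fixes d :: nat and \<alpha> \<epsilon> C :: real and N\<^sub>0 :: nat
  assumes "d \<ge> 3" and "0 < \<epsilon>" and "\<epsilon> < 1" and "C > 0"
  shows "\<exists>(V :: nat set) (E :: nat set set) (w :: nat \<Rightarrow> real) (A :: nat set).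
           fin_simple_graph V E \<and> card V \<ge> N\<^sub>0 \<and>
           (\<forall>v\<in>V. w v > 0) \<and>
           independent_set V E A \<and>
           ((\<forall>v\<in>V. 2 \<le> vertex_degree V E v \<and> vertex_degree V E v \<le> d - 1) \<and> claw_free V E d) \<and>
           (\<forall>X. independent_set V E X \<and> real (card X) \<le> C * log 2 (real (card V)) \<longrightarrow>
                weight_pow w \<alpha> X \<le> weight_pow w \<alpha> (nbhd E X A)) \<and>
           (\<forall>S. max_weight_independent_set V E w S \<longrightarrow>
                weight w S \<ge> (real d - 1 - \<epsilon>) / 2 * weight w A)"
proof -
  have "2 \<le> d - 1"
    using assms(1) by simp
  then obtain n H \<beta> where H: "N\<^sub>0 \<le> n" "fin_simple_graph {..<n} H" "\<And>v. v < n \<Longrightarrow> inc_degree H v \<in> {2..d - 1}"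
    and \<beta>: "0 < \<beta>" "locally_sparse (C * log 2 (n + card H)) (\<beta> powr - \<alpha>) H"
      "(real (d - 1) - \<epsilon>) / 2 * n \<le> \<beta> * card H"
    using ex_weighted_locally_sparse [OF _ assms(2-4)] by blast
  obtain f where "incidence_graph {..<n} H f"
    using ex_incidence_graph [of "{..<n}" H] fin_simple_graph_edges_subset [OF H(2)] by auto
  then interpret incidence_graph "{..<n}" H f .
  let ?w = "block_weight \<beta>"
  have degree: "2 \<le> vertex_degree vertices edges v \<and> vertex_degree vertices edges v \<le> d - 1"
    if "v \<in> vertices" for v
    using vertex_degree_mem [OF _ _ that, of "{2..d - 1}"] H(3) assms(1)
      fin_simple_graph_card_edge [OF H(2)] by auto
  then have "claw_free vertices edges d"
    using assms(1) by (intro claw_free_if_vertex_degree_less finite_vertices) fastforce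
  moreover have "weight_pow ?w \<alpha> X \<le> weight_pow ?w \<alpha> (nbhd edges X {..<n})"
    if "independent_set vertices edges X" "real (card X) \<le> C * log 2 (card vertices)" for X
    using weight_pow_le_nbhd_if_locally_sparse [OF \<beta>(2,1)] that by (simp add: card_vertices)
  moreover have "(real d - 1 - \<epsilon>) / 2 * weight ?w {..<n} \<le> weight ?w S"
    if "max_weight_independent_set vertices edges ?w S" for S
    using weight_blocks_le_max_weight [OF that] \<beta>(3) assms(1) by (simp add: weight_points of_nat_diff)
  moreover have "N\<^sub>0 \<le> card vertices" "\<forall>v\<in>vertices. 0 < ?w v"
    using H(1) \<beta>(1) by (auto simp: card_vertices block_weight_def)
  ultimately show ?thesis
    using fin_simple_graph_vertices_edges independent_set_points degree
    by (intro exI [of _ vertices] exI [of _ edges] exI [of _ ?w] exI [of _ "{..<n}"]) blast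
qed

end
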